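(* Let $X=\{u\in C^2([-1,1]) : u(-1)=u(1)=0\}$ and let $F(u,\lambda)=u''+\lambda e^{u}$ define a continuously differentiable map $F:X\times\mathbb{R}\to C([-1,1])$. Let $\bar\alpha>0$ be the unique positive solution of $\bar\alpha\tanh(\bar\alpha)=1$, and let $$\bar u_0(x)=-2\ln\left[\frac{\cosh(\bar\alpha x)}{\cosh(\bar\alpha)}\right],\qquad \bar\lambda_0=2\left[\frac{\bar\alpha}{\cosh(\bar\alpha)}\right]^2 .$$ If $F(\bar u_0,\bar\lambda_0)=0$, if the kernel of the linear operator $\mathcal{L}=D_uF(\bar u_0,\bar\lambda_0)$ has dimension $1$, and if $$D_\lambda F(\bar u_0,\bar\lambda_0)\notin \mathcal{R}\big(D_uF(\bar u_0,\bar\lambda_0)\big),$$ then there exists a unique continuously differentiable curve $\{(u_0(s),\lambda_0(s)) : s\in(-\delta,\delta)\}$, with $(u_0(0),\lambda_0(0))=(\bar u_0,\bar\lambda_0)$, such that $F(u_0(s),\lambda_0(s))\equiv 0$.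
   Context: $F(u,\lambda)=0$ with $u\in X$ is the one-dimensional Bratu equation $u''(x)+\lambda e^{u(x)}=0$ on $[-1,1]$ with Dirichlet conditions $u(\pm1)=0$ and parameter $\lambda\in\mathbb{R}$. The space $X$ carries the $C^2$ norm and $C([-1,1])$ the supremum norm. $D_uF$ and $D_\lambda F$ are the partial derivatives of $F$, so $D_uF(u,\lambda)w=w''+\lambda e^{u}w$ for $w$ with $w(\pm1)=0$, and $D_\lambda F(u,\lambda)=e^{u}$; $\mathcal{R}(\cdot)$ denotes the range. The number $\delta$ is positive. For $\alpha>0$ the equation $\alpha\tanh(\alpha)=1$ has exactly one solution, denoted $\bar\alpha$. *)

theory Defs
  imports "HOL-Analysis.Analysis"
begin

(* The interval [-1,1] as a metric space, so that C([-1,1]) with the supremum norm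
   is the library type of bounded continuous functions "icc \<Rightarrow>\<^sub>C real". *)
typedef icc = "{-1..1::real}" morphisms real_of_icc Abs_icc
  by (rule exI[of _ 0]) simp

instantiation icc :: metric_space
begin

definition dist_icc :: "icc \<Rightarrow> icc \<Rightarrow> real"
  where "dist_icc x y = dist (real_of_icc x) (real_of_icc y)"

definition uniformity_icc :: "(icc \<times> icc) filter"
  where "uniformity_icc = (INF e\<in>{0<..}. principal {(x, y). dist x y < e})"

definition open_icc :: "icc set \<Rightarrow> bool"
  where "open_icc U \<longleftrightarrow> (\<forall>x\<in>U. \<forall>\<^sub>F (x', y) in uniformity. x' = x \<longrightarrow> y \<in> U)"

instance
  by standard
    (auto simp: dist_icc_def uniformity_icc_def open_icc_def real_of_icc_inject
      intro: dist_triangle2)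

end

lemma real_of_icc_mem [simp]: "real_of_icc x \<in> {-1..1}" "-1 \<le> real_of_icc x" "real_of_icc x \<le> 1"
  using real_of_icc[of x] by auto

lemma continuous_on_real_of_icc: "continuous_on UNIV real_of_icc"
  unfolding continuous_on_iff by (auto simp: dist_icc_def)

definition icc_fun :: "(real \<Rightarrow> real) \<Rightarrow> icc \<Rightarrow>\<^sub>C real"
  where "icc_fun g = Bcontfun (\<lambda>x. g (real_of_icc x))"

lemma apply_icc_fun:
  assumes "continuous_on {-1..1} g"
  shows "apply_bcontfun (icc_fun g) x = g (real_of_icc x)"
proof -
  have "continuous_on UNIV (\<lambda>x. g (real_of_icc x))"
    by (rule continuous_on_compose2[OF assms continuous_on_real_of_icc]) auto
  moreover have "bounded (range (\<lambda>x. g (real_of_icc x)))"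
    by (rule bounded_subset[OF compact_imp_bounded[OF compact_continuous_image[OF assms]]]) auto
  ultimately have "(\<lambda>x. g (real_of_icc x)) \<in> bcontfun"
    by (simp add: bcontfun_def)
  then show ?thesis
    by (simp add: icc_fun_def Bcontfun_inverse)
qed

(* derivative on [-1,1], one-sided at the end points *)
definition icc_deriv :: "(real \<Rightarrow> real) \<Rightarrow> real \<Rightarrow> real"
  where "icc_deriv u x = vector_derivative u (at x within {-1..1})"

definition C2_icc :: "(real \<Rightarrow> real) \<Rightarrow> bool"
  where "C2_icc u \<longleftrightarrow> u differentiable_on {-1..1} \<and> icc_deriv u differentiable_on {-1..1} \<and>
     continuous_on {-1..1} (icc_deriv (icc_deriv u))"

lemma icc_deriv_works:
  assumes "u differentiable_on {-1..1}" "x \<in> {-1..1}"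
  shows "(u has_vector_derivative icc_deriv u x) (at x within {-1..1})"
  using assms unfolding icc_deriv_def differentiable_on_def
  by (subst vector_derivative_works[symmetric]) auto

lemma icc_deriv_eqI:
  assumes "(u has_vector_derivative d) (at x within {-1..1})" "x \<in> {-1..1}"
  shows "icc_deriv u x = d"
  using vector_derivative_within_cbox[of "-1" 1 x u d] assms
  by (simp add: icc_deriv_def box_real)

lemma C2_iccI:
  assumes 1: "\<And>x. x \<in> {-1..1} \<Longrightarrow> (u has_vector_derivative u1 x) (at x within {-1..1})"
    and 2: "\<And>x. x \<in> {-1..1} \<Longrightarrow> (u1 has_vector_derivative u2 x) (at x within {-1..1})"
    and 3: "continuous_on {-1..1} u2"
  shows "C2_icc u" "\<And>x. x \<in> {-1..1} \<Longrightarrow> icc_deriv u x = u1 x"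
    "\<And>x. x \<in> {-1..1} \<Longrightarrow> icc_deriv (icc_deriv u) x = u2 x"
proof -
  show d1: "icc_deriv u x = u1 x" if "x \<in> {-1..1}" for x
    using 1 that by (intro icc_deriv_eqI)
  have h2: "(icc_deriv u has_vector_derivative u2 x) (at x within {-1..1})" if "x \<in> {-1..1}" for x
    by (rule has_vector_derivative_transform[OF that _ 2[OF that]]) (simp add: d1)
  show d2: "icc_deriv (icc_deriv u) x = u2 x" if "x \<in> {-1..1}" for x
    using h2 that by (intro icc_deriv_eqI)
  have "continuous_on {-1..1} (icc_deriv (icc_deriv u))"
    using 3 by (subst continuous_on_cong[OF refl d2]) auto
  then show "C2_icc u"
    unfolding C2_icc_def differentiable_on_def
    using 1 h2 by (blast intro: differentiableI_vector)
qed

lemma C2_iccD: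
  assumes "C2_icc u"
  shows "\<And>x. x \<in> {-1..1} \<Longrightarrow> (u has_vector_derivative icc_deriv u x) (at x within {-1..1})"
    "\<And>x. x \<in> {-1..1} \<Longrightarrow>
       (icc_deriv u has_vector_derivative icc_deriv (icc_deriv u) x) (at x within {-1..1})"
    "continuous_on {-1..1} (icc_deriv (icc_deriv u))"
    "continuous_on {-1..1} (icc_deriv u)" "continuous_on {-1..1} u"
  using assms unfolding C2_icc_def
  by (auto intro: icc_deriv_works differentiable_imp_continuous_on)

(* The space X.  Functions are extended by 0 outside [-1,1] so that equality in the
   type is equality on [-1,1]; C2_icc only depends on the values on [-1,1]. *)
typedef dirichlet_C2 =
  "{u :: real \<Rightarrow> real. C2_icc u \<and> u (-1) = 0 \<and> u 1 = 0 \<and> (\<forall>x. x \<notin> {-1..1} \<longrightarrow> u x = 0)}"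
  morphisms state Abs_dirichlet_C2
  by (rule exI[of _ "\<lambda>_. 0"]) (auto intro!: C2_iccI(1)[where ?u1.0 = "\<lambda>_. 0" and ?u2.0 = "\<lambda>_. 0"])

abbreviation state' :: "dirichlet_C2 \<Rightarrow> real \<Rightarrow> real"
  where "state' u \<equiv> icc_deriv (state u)"

abbreviation state'' :: "dirichlet_C2 \<Rightarrow> real \<Rightarrow> real"
  where "state'' u \<equiv> icc_deriv (icc_deriv (state u))"

lemma state_C2: "C2_icc (state u)"
  and state_bdry [simp]: "state u (-1) = 0" "state u 1 = 0"
  and state_outside: "x \<notin> {-1..1} \<Longrightarrow> state u x = 0"
  using state[of u] by blast+

lemmas state_deriv = C2_iccD[OF state_C2]

lemma state_combination:
  "C2_icc (\<lambda>x. a * state u x + b * state v x)"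
  "x \<in> {-1..1} \<Longrightarrow> icc_deriv (\<lambda>x. a * state u x + b * state v x) x = a * state' u x + b * state' v x"
  "x \<in> {-1..1} \<Longrightarrow> icc_deriv (icc_deriv (\<lambda>x. a * state u x + b * state v x)) x
      = a * state'' u x + b * state'' v x"
proof -
  note C2 = C2_iccI[of "\<lambda>x. a * state u x + b * state v x"
      "\<lambda>x. a * state' u x + b * state' v x" "\<lambda>x. a * state'' u x + b * state'' v x"]
  have 1: "((\<lambda>x. a * state u x + b * state v x) has_vector_derivative a * state' u x + b * state' v x)
      (at x within {-1..1})" if "x \<in> {-1..1}" for x
    by (intro has_vector_derivative_add has_vector_derivative_mult_right state_deriv(1) that)
  have 2: "((\<lambda>x. a * state' u x + b * state' v x) has_vector_derivative a * state'' u x + b * state'' v x)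
      (at x within {-1..1})" if "x \<in> {-1..1}" for x
    by (intro has_vector_derivative_add has_vector_derivative_mult_right state_deriv(2) that)
  have 3: "continuous_on {-1..1} (\<lambda>x. a * state'' u x + b * state'' v x)"
    by (intro continuous_intros state_deriv(3))
  show "C2_icc (\<lambda>x. a * state u x + b * state v x)"
    and "x \<in> {-1..1} \<Longrightarrow> icc_deriv (\<lambda>x. a * state u x + b * state v x) x = a * state' u x + b * state' v x"
    and "x \<in> {-1..1} \<Longrightarrow> icc_deriv (icc_deriv (\<lambda>x. a * state u x + b * state v x)) x
      = a * state'' u x + b * state'' v x"
    using C2[OF 1 2 3] by auto
qed

lemma state_Abs_combination:
  "state (Abs_dirichlet_C2 (\<lambda>x. a * state u x + b * state v x)) = (\<lambda>x. a * state u x + b * state v x)"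
  by (rule Abs_dirichlet_C2_inverse) (auto simp: state_combination state_outside)

instantiation dirichlet_C2 :: real_vector
begin

definition zero_dirichlet_C2 :: dirichlet_C2
  where "0 = Abs_dirichlet_C2 (\<lambda>_. 0)"

definition plus_dirichlet_C2 :: "dirichlet_C2 \<Rightarrow> dirichlet_C2 \<Rightarrow> dirichlet_C2"
  where "u + v = Abs_dirichlet_C2 (\<lambda>x. state u x + state v x)"

definition minus_dirichlet_C2 :: "dirichlet_C2 \<Rightarrow> dirichlet_C2 \<Rightarrow> dirichlet_C2"
  where "u - v = Abs_dirichlet_C2 (\<lambda>x. state u x - state v x)"

definition uminus_dirichlet_C2 :: "dirichlet_C2 \<Rightarrow> dirichlet_C2"
  where "- u = Abs_dirichlet_C2 (\<lambda>x. - state u x)"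

definition scaleR_dirichlet_C2 :: "real \<Rightarrow> dirichlet_C2 \<Rightarrow> dirichlet_C2"
  where "r *\<^sub>R u = Abs_dirichlet_C2 (\<lambda>x. r * state u x)"

lemma state_simps [simp]:
  "state 0 = (\<lambda>_. 0)"
  "state (u + v) = (\<lambda>x. state u x + state v x)"
  "state (u - v) = (\<lambda>x. state u x - state v x)"
  "state (- u) = (\<lambda>x. - state u x)"
  "state (r *\<^sub>R u) = (\<lambda>x. r * state u x)"
  using state_Abs_combination[of 0 u 0 u] state_Abs_combination[of 1 u 1 v]
    state_Abs_combination[of 1 u "-1" v] state_Abs_combination[of "-1" u 0 u]
    state_Abs_combination[of r u 0 u]
  by (simp_all add: zero_dirichlet_C2_def plus_dirichlet_C2_def minus_dirichlet_C2_def
      uminus_dirichlet_C2_def scaleR_dirichlet_C2_def)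

instance
  by standard (auto simp: state_inject[symmetric] algebra_simps)

end

lemma state'_simps:
  assumes "x \<in> {-1..1}"
  shows "icc_deriv (state (u + v)) x = state' u x + state' v x"
    and "icc_deriv (state (r *\<^sub>R u)) x = r * state' u x"
    and "icc_deriv (icc_deriv (state (u + v))) x = state'' u x + state'' v x"
    and "icc_deriv (icc_deriv (state (r *\<^sub>R u))) x = r * state'' u x"
  using assms state_combination(2,3)[of x 1 u 1 v] state_combination(2,3)[of x r u 0 u] by simp_all

lemma icc_fun_state:
  "apply_bcontfun (icc_fun (state u)) x = state u (real_of_icc x)"
  "apply_bcontfun (icc_fun (state' u)) x = state' u (real_of_icc x)"
  "apply_bcontfun (icc_fun (state'' u)) x = state'' u (real_of_icc x)"
  by (auto intro!: apply_icc_fun state_deriv)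

lemma icc_fun_state_add:
  "icc_fun (state (u + v)) = icc_fun (state u) + icc_fun (state v)"
  "icc_fun (state' (u + v)) = icc_fun (state' u) + icc_fun (state' v)"
  "icc_fun (state'' (u + v)) = icc_fun (state'' u) + icc_fun (state'' v)"
  by (auto intro!: bcontfun_eqI simp: icc_fun_state state'_simps simp del: state_simps)
    (simp add: state_simps)

lemma icc_fun_state_scaleR:
  "icc_fun (state (r *\<^sub>R u)) = r *\<^sub>R icc_fun (state u)"
  "icc_fun (state' (r *\<^sub>R u)) = r *\<^sub>R icc_fun (state' u)"
  "icc_fun (state'' (r *\<^sub>R u)) = r *\<^sub>R icc_fun (state'' u)"
  by (auto intro!: bcontfun_eqI simp: icc_fun_state state'_simps simp del: state_simps)
    (simp add: state_simps)

instantiation dirichlet_C2 :: real_normed_vector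
begin

definition norm_dirichlet_C2 :: "dirichlet_C2 \<Rightarrow> real"
  where "norm u = norm (icc_fun (state u)) + norm (icc_fun (state' u)) + norm (icc_fun (state'' u))"

definition sgn_dirichlet_C2 :: "dirichlet_C2 \<Rightarrow> dirichlet_C2"
  where "sgn_dirichlet_C2 u = u /\<^sub>R norm u"

definition dist_dirichlet_C2 :: "dirichlet_C2 \<Rightarrow> dirichlet_C2 \<Rightarrow> real"
  where "dist_dirichlet_C2 u v = norm (u - v)"

definition uniformity_dirichlet_C2 :: "(dirichlet_C2 \<times> dirichlet_C2) filter"
  where "uniformity_dirichlet_C2 = (INF e\<in>{0<..}. principal {(x, y). dist x y < e})"

definition open_dirichlet_C2 :: "dirichlet_C2 set \<Rightarrow> bool"
  where "open_dirichlet_C2 U \<longleftrightarrow> (\<forall>x\<in>U. \<forall>\<^sub>F (x', y) in uniformity. x' = x \<longrightarrow> y \<in> U)"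

instance
proof
  fix u v :: dirichlet_C2 and r :: real
  show "norm u = 0 \<longleftrightarrow> u = 0"
  proof
    assume "norm u = 0"
    then have "norm (icc_fun (state u)) = 0"
      unfolding norm_dirichlet_C2_def
      using norm_ge_zero[of "icc_fun (state u)"] norm_ge_zero[of "icc_fun (state' u)"]
        norm_ge_zero[of "icc_fun (state'' u)"] by linarith
    then have z: "apply_bcontfun (icc_fun (state u)) x = 0" for x
      by simp
    have "state u x = 0" for x
    proof (cases "x \<in> {-1..1}")
      case True
      then show ?thesis
        using z[of "Abs_icc x"] by (simp add: icc_fun_state Abs_icc_inverse)
    qed (simp add: state_outside)
    then show "u = 0"
      by (auto simp: state_inject[symmetric])
  next
    assume "u = 0"
    then show "norm u = 0"
      using icc_fun_state_scaleR[of 0 u] by (simp add: norm_dirichlet_C2_def)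
  qed
  have "norm (icc_fun (state (u + v))) \<le> norm (icc_fun (state u)) + norm (icc_fun (state v))"
    and "norm (icc_fun (state' (u + v))) \<le> norm (icc_fun (state' u)) + norm (icc_fun (state' v))"
    and "norm (icc_fun (state'' (u + v))) \<le> norm (icc_fun (state'' u)) + norm (icc_fun (state'' v))"
    unfolding icc_fun_state_add by (rule norm_triangle_ineq)+
  then show "norm (u + v) \<le> norm u + norm v"
    unfolding norm_dirichlet_C2_def by linarith
  show "norm (r *\<^sub>R u) = \<bar>r\<bar> * norm u"
    unfolding norm_dirichlet_C2_def icc_fun_state_scaleR by (simp add: algebra_simps)
qed (simp_all add: sgn_dirichlet_C2_def dist_dirichlet_C2_def uniformity_dirichlet_C2_def
    open_dirichlet_C2_def)

end

definition bratu :: "dirichlet_C2 \<times> real \<Rightarrow> icc \<Rightarrow>\<^sub>C real"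
  where "bratu = (\<lambda>(u, l). icc_fun (\<lambda>x. state'' u x + l * exp (state u x)))"

lemma apply_bratu:
  "apply_bcontfun (bratu (u, l)) x = state'' u (real_of_icc x) + l * exp (state u (real_of_icc x))"
  unfolding bratu_def by (simp, subst apply_icc_fun) (auto intro!: continuous_intros state_deriv)

(* Partial Frechet derivatives; bratu_deriv_u_apply and bratu_deriv_l_apply below
   give the explicit formulas. *)
definition bratu_deriv_u :: "dirichlet_C2 \<Rightarrow> real \<Rightarrow> dirichlet_C2 \<Rightarrow> icc \<Rightarrow>\<^sub>C real"
  where "bratu_deriv_u u l = frechet_derivative (\<lambda>v. bratu (v, l)) (at u)"

definition bratu_deriv_l :: "dirichlet_C2 \<Rightarrow> real \<Rightarrow> icc \<Rightarrow>\<^sub>C real"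
  where "bratu_deriv_l u l = vector_derivative (\<lambda>m. bratu (u, m)) (at l)"

lemma exp_remainder_le:
  fixes t :: real
  assumes "\<bar>t\<bar> \<le> 1"
  shows "\<bar>exp t - 1 - t\<bar> \<le> t\<^sup>2"
proof -
  have "exp t \<le> 1 + t + t\<^sup>2"
  proof (cases "t \<ge> 0")
    case True
    then show ?thesis using assms exp_bound[of t] by simp
  next
    case False
    have "exp t * (1 - t) \<le> exp t * exp (- t)"
      using exp_ge_add_one_self[of "-t"] by (intro mult_left_mono) auto
    also have "\<dots> = 1" by (simp add: exp_minus_inverse)
    also have "1 \<le> (1 + t + t\<^sup>2) * (1 - t)"
      using False zero_le_power[of "-t" 3]
      by (simp add: algebra_simps power2_eq_square power3_eq_cube)
    finally show ?thesis
      using False by (simp add: mult_le_cancel_right)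
  qed
  then show ?thesis using exp_ge_add_one_self[of t] by linarith
qed

lemma bratu_has_derivative_u:
  "((\<lambda>v. bratu (v, l)) has_derivative
     (\<lambda>w. icc_fun (\<lambda>x. state'' w x + l * exp (state u x) * state w x))) (at u)"
proof -
  let ?L = "\<lambda>w. icc_fun (\<lambda>x. state'' w x + l * exp (state u x) * state w x)"
  define K where "K = exp (norm (icc_fun (state u)))"
  have L: "apply_bcontfun (?L w) x = state'' w (real_of_icc x) +
      l * exp (state u (real_of_icc x)) * state w (real_of_icc x)" for w x
    by (subst apply_icc_fun) (auto intro!: continuous_intros state_deriv)
  have K: "exp (state u (real_of_icc x)) \<le> K" for x
    using norm_bounded[of "icc_fun (state u)" x] by (simp add: K_def icc_fun_state)
  have sup: "\<bar>state w (real_of_icc x)\<bar> \<le> norm w" for w x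
    using norm_bounded[of "icc_fun (state w)" x] norm_ge_zero[of "icc_fun (state' w)"]
      norm_ge_zero[of "icc_fun (state'' w)"]
    unfolding norm_dirichlet_C2_def icc_fun_state real_norm_def by linarith
  have sup2: "\<bar>state'' w (real_of_icc x)\<bar> \<le> norm w" for w x
    using norm_bounded[of "icc_fun (state'' w)" x] norm_ge_zero[of "icc_fun (state' w)"]
      norm_ge_zero[of "icc_fun (state w)"]
    unfolding norm_dirichlet_C2_def icc_fun_state real_norm_def by linarith
  have lin: "bounded_linear ?L"
  proof (rule bounded_linear_intro)
    show "?L (v + w) = ?L v + ?L w" for v w
      by (rule bcontfun_eqI, unfold plus_bcontfun.rep_eq L)
        (simp add: state'_simps[unfolded state_simps] algebra_simps)
    show "?L (r *\<^sub>R w) = r *\<^sub>R ?L w" for r w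
      by (rule bcontfun_eqI, unfold scaleR_bcontfun.rep_eq L)
        (simp add: state'_simps[unfolded state_simps] algebra_simps)
    show "norm (?L w) \<le> norm w * (1 + \<bar>l\<bar> * K)" for w
    proof (rule norm_bound)
      fix x
      have "\<bar>l * exp (state u (real_of_icc x)) * state w (real_of_icc x)\<bar> \<le> \<bar>l\<bar> * K * norm w"
        unfolding abs_mult using K sup by (intro mult_mono) (auto simp: K_def)
      then show "norm (apply_bcontfun (?L w) x) \<le> norm w * (1 + \<bar>l\<bar> * K)"
        using sup2[of w x] unfolding L real_norm_def by (simp add: algebra_simps)
    qed
  qed
  have est: "norm (bratu (u + w, l) - bratu (u, l) - ?L w) \<le> \<bar>l\<bar> * K * (norm w)\<^sup>2"
    if "norm w \<le> 1" for w
  proof (rule norm_bound)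
    fix x
    let ?w = "state w (real_of_icc x)" and ?e = "exp (state u (real_of_icc x))"
    have "apply_bcontfun (bratu (u + w, l) - bratu (u, l) - ?L w) x
        = l * (?e * (exp ?w - 1 - ?w))"
      unfolding minus_bcontfun.rep_eq apply_bratu L
      by (simp add: state'_simps[unfolded state_simps] exp_add algebra_simps)
    also have "\<bar>\<dots>\<bar> \<le> \<bar>l\<bar> * (K * (norm w)\<^sup>2)"
      unfolding abs_mult
    proof (intro mult_mono)
      have w: "\<bar>?w\<bar> \<le> norm w" by (rule sup)
      have "\<bar>exp ?w - 1 - ?w\<bar> \<le> ?w\<^sup>2"
        using w that by (intro exp_remainder_le) linarith
      also have "\<dots> \<le> (norm w)\<^sup>2"
        using w by (metis abs_le_square_iff abs_norm_cancel)
      finally show "\<bar>exp ?w - 1 - ?w\<bar> \<le> (norm w)\<^sup>2" .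
    qed (use K in \<open>auto simp: K_def\<close>)
    finally show "norm (apply_bcontfun (bratu (u + w, l) - bratu (u, l) - ?L w) x)
        \<le> \<bar>l\<bar> * K * (norm w)\<^sup>2"
      by (simp add: algebra_simps)
  qed
  show ?thesis
    unfolding has_derivative_at_alt
  proof (intro conjI lin allI impI)
    fix e :: real assume "0 < e"
    define d where "d = min 1 (e / (\<bar>l\<bar> * K + 1))"
    have K0: "0 \<le> \<bar>l\<bar> * K" by (simp add: K_def)
    have "d > 0" using \<open>0 < e\<close> K0 by (simp add: d_def)
    moreover have "norm (bratu (v, l) - bratu (u, l) - ?L (v - u)) \<le> e * norm (v - u)"
      if "norm (v - u) < d" for v
    proof -
      have "norm (v - u) \<le> e / (\<bar>l\<bar> * K + 1)" using that by (simp add: d_def)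
      then have "(\<bar>l\<bar> * K + 1) * norm (v - u) \<le> e"
        using K0 by (simp add: pos_le_divide_eq mult.commute)
      then have "\<bar>l\<bar> * K * norm (v - u) \<le> e"
        by (simp add: distrib_right) (use norm_ge_zero[of "v - u"] in linarith)
      then have "\<bar>l\<bar> * K * norm (v - u) * norm (v - u) \<le> e * norm (v - u)"
        by (rule mult_right_mono) simp
      then show ?thesis
        using est[of "v - u"] that by (simp add: d_def power2_eq_square algebra_simps)
    qed
    ultimately show "\<exists>d>0. \<forall>v. norm (v - u) < d \<longrightarrow>
        norm (bratu (v, l) - bratu (u, l) - ?L (v - u)) \<le> e * norm (v - u)"
      by blast
  qed
qed

lemma bratu_deriv_u_apply:
  "bratu_deriv_u u l w = icc_fun (\<lambda>x. state'' w x + l * exp (state u x) * state w x)"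
  unfolding bratu_deriv_u_def frechet_derivative_at[OF bratu_has_derivative_u, symmetric] ..

lemma bratu_deriv_l_apply: "bratu_deriv_l u l = icc_fun (\<lambda>x. exp (state u x))"
proof -
  have "bratu (u, m) = icc_fun (state'' u) + m *\<^sub>R icc_fun (\<lambda>x. exp (state u x))" for m
    by (rule bcontfun_eqI, simp add: apply_bratu icc_fun_state, subst apply_icc_fun)
      (auto intro!: continuous_intros state_deriv)
  then show ?thesis
    unfolding bratu_deriv_l_def
    by (intro vector_derivative_at) (auto intro!: derivative_eq_intros)
qed

definition bratu_u :: "real \<Rightarrow> dirichlet_C2"
  where "bratu_u a = Abs_dirichlet_C2
    (\<lambda>x. if x \<in> {-1..1} then -2 * ln (cosh (a * x) / cosh a) else 0)"

definition bratu_l :: "real \<Rightarrow> real"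
  where "bratu_l a = 2 * (a / cosh a)\<^sup>2"

lemma state_bratu_u:
  "state (bratu_u a) = (\<lambda>x. if x \<in> {-1..1} then -2 * ln (cosh (a * x) / cosh a) else 0)"
  unfolding bratu_u_def
proof (rule Abs_dirichlet_C2_inverse, safe)
  let ?u = "\<lambda>x. if x \<in> {-1..1} then -2 * ln (cosh (a * x) / cosh a) else 0"
  show "C2_icc ?u"
  proof (rule C2_iccI(1))
    fix x :: real assume x: "x \<in> {-1..1}"
    have "((\<lambda>x. -2 * ln (cosh (a * x) / cosh a)) has_real_derivative -2 * a * tanh (a * x))
        (at x within {-1..1})"
      by (auto intro!: derivative_eq_intros simp: tanh_def)
    then show "(?u has_vector_derivative -2 * a * tanh (a * x)) (at x within {-1..1})"
      unfolding has_real_derivative_iff_has_vector_derivative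
      by (rule has_vector_derivative_transform[OF x, rotated]) simp
    have "((\<lambda>x. -2 * a * tanh (a * x)) has_real_derivative -2 * a * (a * (1 - (tanh (a * x))\<^sup>2)))
        (at x within {-1..1})"
      by (auto intro!: derivative_eq_intros)
    then show "((\<lambda>x. -2 * a * tanh (a * x)) has_vector_derivative
        -2 * a * (a * (1 - (tanh (a * x))\<^sup>2))) (at x within {-1..1})"
      unfolding has_real_derivative_iff_has_vector_derivative .
  qed (auto intro!: continuous_intros)
qed auto

(* A continuously differentiable curve of solutions; c is only constrained on (-d,d). *)
definition bratu_curve :: "real \<Rightarrow> (real \<Rightarrow> dirichlet_C2 \<times> real) \<Rightarrow> bool"
  where "bratu_curve d c \<longleftrightarrow>
    c C1_differentiable_on {-d<..<d} \<and> (\<forall>s\<in>{-d<..<d}. bratu (c s) = 0)"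

(* Uniqueness of the curve {c s : s in (-d,d)} through p = c 0.  Parametrised curves are
   never literally unique (reparametrise, or take the constant curve), so, as usual for
   curves given by the implicit function theorem, uniqueness is local and up to
   reparametrisation: c is an immersion, every zero of F near p lies on c, and every
   C^1 solution curve c' through p is near p of the form c o phi with phi of class C^1.
   If c' is itself an immersion, the chain rule makes the derivative of phi nonzero. *)
definition unique_bratu_curve :: "real \<Rightarrow> (real \<Rightarrow> dirichlet_C2 \<times> real) \<Rightarrow> bool"
  where "unique_bratu_curve d c \<longleftrightarrow>
    (\<forall>s\<in>{-d<..<d}. vector_derivative c (at s) \<noteq> 0) \<and>
    (\<exists>U. open U \<and> c 0 \<in> U \<and> (\<forall>p\<in>U. bratu p = 0 \<longrightarrow> p \<in> c ` {-d<..<d})) \<and>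
    (\<forall>e>0. \<forall>c'. bratu_curve e c' \<and> c' 0 = c 0 \<longrightarrow>
      (\<exists>r\<in>{0<..e}. \<exists>\<phi> :: real \<Rightarrow> real. \<phi> C1_differentiable_on {-r<..<r} \<and> \<phi> 0 = 0 \<and>
        (\<forall>t\<in>{-r<..<r}. \<phi> t \<in> {-d<..<d} \<and> c' t = c (\<phi> t))))"

end

theory Submission
  imports Defs
begin

text \<open>
  The solution set of the Bratu problem with positive parameter can be written down completely, and
  it is a single smooth curve: the solutions are exactly $(u_\theta, \lambda_\theta)$ with
  $u_\theta(x) = -2 \ln (\cosh(\theta x) / \cosh\theta)$,
  $\lambda_\theta = 2 (\theta / \cosh\theta)^2$ and $\theta > 0$. The turning point is the
  parameter value $\theta = \alpha$, so $s \mapsto (u_{\alpha+s}, \lambda_{\alpha+s})$ for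
  $|s| < \alpha$ is the required curve. Existence and uniqueness come from integrating the
  differential equation.

  Why there are no other solutions (\<open>bratu_solution_explicit\<close>): along a solution the
  energy $u'^2/2 + \lambda e^u = 2\theta^2$ is constant, and the substitution $v = e^{-u/2}$ turns
  the equation into the linear one $v'' = \theta^2 v$. The boundary conditions become
  $v(\pm 1) = 1$ and force $v(x) = \cosh(\theta x) / \cosh\theta$.

  The parameter of a solution is recovered from the height of its midpoint, since
  $u_\theta(0) = 2 \ln\cosh\theta$. This has three consequences. The midpoint of the tangent to the
  curve is $2 \tanh\theta > 0$, so the curve is an immersion. The conditions $\lambda > 0$ and
  $u(0) < 2 \ln\cosh(2\alpha)$ define a neighbourhood in which every solution lies on the curve. And
  a differentiable curve of solutions is a reparametrisation of this one by
  $\mathrm{arcosh}\,(e^{u(0)/2}) - \alpha$, which is as smooth as the curve itself, because point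
  evaluation is linear and bounded.

  That the branch is continuously differentiable as a curve in the space with the $C^2$ norm is
  reduced to joint continuity in $(\theta, x)$ of the pointwise parameter derivatives of $u$, $u'$
  and $u''$ (\<open>has_vector_derivative_icc_fun\<close>,
  \<open>has_vector_derivative_dirichlet_C2\<close>).
\<close>

section \<open>Curves in spaces of functions on $[-1,1]$\<close>

lemma continuous_on_slice:
  fixes g :: "real \<Rightarrow> real \<Rightarrow> real"
  assumes "continuous_on UNIV (\<lambda>p. g (fst p) (snd p))"
  shows "continuous_on S (g a)"
  using continuous_on_compose2[OF assms, of S "\<lambda>x. (a, x)"] by (simp add: continuous_intros)

text \<open>Compactness of $[-1,1]$ makes the continuity in the parameter uniform in $x$, which is
  what convergence in the supremum norm asks for.\<close>

lemma continuous_on_icc_fun_parameter: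
  fixes g :: "real \<Rightarrow> real \<Rightarrow> real"
  assumes g: "continuous_on UNIV (\<lambda>p. g (fst p) (snd p))"
  shows "continuous_on UNIV (\<lambda>a. icc_fun (g a))"
  unfolding continuous_on_iff
proof (intro ballI allI impI)
  fix a e :: real assume "0 < e"
  have "continuous_on (UNIV \<times> {-1..1}) (\<lambda>p. g (fst p) (snd p))"
    using g by (rule continuous_on_subset) simp
  from continuous_on_prod_compactE[OF this compact_Icc UNIV_I half_gt_zero[OF \<open>0 < e\<close>], of a]
  obtain A where A: "a \<in> A" "open A"
    and le: "\<forall>b\<in>A \<inter> UNIV. \<forall>x\<in>{-1..1}. 
      dist (g (fst (b, x)) (snd (b, x))) (g (fst (a, x)) (snd (a, x))) \<le> e / 2"
    by metis
  from A obtain d where d: "d > 0" "ball a d \<subseteq> A" by (meson open_contains_ball)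
  have "dist (icc_fun (g b)) (icc_fun (g a)) < e" if "dist b a < d" for b
  proof -
    have "b \<in> A" using d(2) that by (auto simp: dist_commute)
    then have "dist (icc_fun (g b)) (icc_fun (g a)) \<le> e / 2"
      by (intro dist_bound) (simp add: apply_icc_fun continuous_on_slice[OF g] le[simplified])
    then show ?thesis using \<open>0 < e\<close> by simp
  qed
  then show "\<exists>d>0. \<forall>b\<in>UNIV. dist b a < d \<longrightarrow> dist (icc_fun (g b)) (icc_fun (g a)) < e"
    using d(1) by blast
qed

text \<open>By the mean value theorem the error of the linear approximation at $x$ is
  $(b - a)(g'(c,x) - g'(a,x))$. The intermediate $c$ depends on $x$, but the second factor is at most
  the supremum distance of $g'(c,\cdot)$ and $g'(a,\cdot)$, and that distance is uniformly small for all
  $c$ near $a$ by the preceding lemma.\<close>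

lemma has_vector_derivative_icc_fun:
  fixes g g' :: "real \<Rightarrow> real \<Rightarrow> real"
  assumes g: "continuous_on UNIV (\<lambda>p. g (fst p) (snd p))"
    and g': "continuous_on UNIV (\<lambda>p. g' (fst p) (snd p))"
    and deriv: "\<And>a x. ((\<lambda>a. g a x) has_real_derivative g' a x) (at a)"
  shows "((\<lambda>a. icc_fun (g a)) has_vector_derivative icc_fun (g' a)) (at a)"
  unfolding has_vector_derivative_def has_derivative_at_alt
proof (intro conjI allI impI bounded_linear_scaleR_left)
  fix e :: real assume "0 < e"
  then obtain d where d: "d > 0"
    and near: "\<And>c. dist c a < d \<Longrightarrow> dist (icc_fun (g' c)) (icc_fun (g' a)) < e"
    using continuous_on_icc_fun_parameter[OF g'] unfolding continuous_on_iff by (metis UNIV_I)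
  have "norm (icc_fun (g b) - icc_fun (g a) - (b - a) *\<^sub>R icc_fun (g' a)) \<le> e * norm (b - a)"
    if b: "norm (b - a) < d" for b
  proof (rule norm_bound)
    fix x
    let ?x = "real_of_icc x"
    obtain c where c: "dist c a \<le> norm (b - a)" "g b ?x - g a ?x = (b - a) * g' c ?x"
    proof (cases a b rule: linorder_cases)
      case less
      then obtain z where "a < z" "z < b" "g b ?x - g a ?x = (b - a) * g' z ?x"
        using MVT2[of a b "\<lambda>a. g a ?x" "\<lambda>a. g' a ?x"] deriv by blast
      then show ?thesis using that[of z] by (simp add: dist_real_def)
    next
      case greater
      then obtain z where "b < z" "z < a" "g a ?x - g b ?x = (a - b) * g' z ?x"
        using MVT2[of b a "\<lambda>a. g a ?x" "\<lambda>a. g' a ?x"] deriv by blast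
      moreover from this have "g b ?x - g a ?x = (b - a) * g' z ?x"
        unfolding left_diff_distrib by linarith
      ultimately show ?thesis using that[of z] by (simp add: dist_real_def)
    next
      case equal
      then show ?thesis using that[of a] by simp
    qed
    have "\<bar>g' c ?x - g' a ?x\<bar> \<le> dist (icc_fun (g' c)) (icc_fun (g' a))"
      using dist_bounded[of "icc_fun (g' c)" x "icc_fun (g' a)"]
      by (simp add: apply_icc_fun continuous_on_slice[OF g'] dist_real_def)
    also have "\<dots> < e" using near c(1) b by simp
    finally have "\<bar>b - a\<bar> * \<bar>g' c ?x - g' a ?x\<bar> \<le> \<bar>b - a\<bar> * e"
      by (intro mult_left_mono) auto
    moreover have "apply_bcontfun (icc_fun (g b) - icc_fun (g a) - (b - a) *\<^sub>R icc_fun (g' a)) x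
        = (b - a) * (g' c ?x - g' a ?x)"
      using c(2) by (simp add: apply_icc_fun continuous_on_slice[OF g] continuous_on_slice[OF g']
          right_diff_distrib)
    ultimately show "norm (apply_bcontfun (icc_fun (g b) - icc_fun (g a) -
        (b - a) *\<^sub>R icc_fun (g' a)) x) \<le> e * norm (b - a)"
      by (simp add: abs_mult mult.commute)
  qed
  then show "\<exists>d>0. \<forall>b. norm (b - a) < d \<longrightarrow>
      norm (icc_fun (g b) - icc_fun (g a) - (b - a) *\<^sub>R icc_fun (g' a)) \<le> e * norm (b - a)"
    using d by blast
qed

lemma icc_fun_state_diff:
  "icc_fun (state (u - v)) = icc_fun (state u) - icc_fun (state v)"
  "icc_fun (state' (u - v)) = icc_fun (state' u) - icc_fun (state' v)"
  "icc_fun (state'' (u - v)) = icc_fun (state'' u) - icc_fun (state'' v)"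
  using icc_fun_state_add[of "u - v" v] by (simp_all del: state_simps)

text \<open>The $C^2$ norm is the sum of the supremum norms of $u$, $u'$ and $u''$, so continuity and
  differentiability of a curve can be tested on these three components.\<close>

lemma continuous_on_dirichlet_C2:
  fixes V :: "real \<Rightarrow> dirichlet_C2"
  assumes "continuous_on S (\<lambda>a. icc_fun (state (V a)))"
    and "continuous_on S (\<lambda>a. icc_fun (state' (V a)))"
    and "continuous_on S (\<lambda>a. icc_fun (state'' (V a)))"
  shows "continuous_on S V"
proof -
  have "((\<lambda>b. norm (V b - V a)) \<longlongrightarrow> 0 + 0 + 0) (at a within S)" if "a \<in> S" for a
    unfolding norm_dirichlet_C2_def icc_fun_state_diff
    using assms that unfolding continuous_on_def
    by (intro tendsto_add tendsto_norm_zero LIM_zero) auto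
  then show ?thesis
    unfolding continuous_on_def by (auto intro: LIM_zero_cancel tendsto_norm_zero_cancel)
qed

lemma has_vector_derivative_dirichlet_C2:
  fixes U :: "real \<Rightarrow> dirichlet_C2"
  assumes "((\<lambda>a. icc_fun (state (U a))) has_vector_derivative icc_fun (state v)) (at a)"
    and "((\<lambda>a. icc_fun (state' (U a))) has_vector_derivative icc_fun (state' v)) (at a)"
    and "((\<lambda>a. icc_fun (state'' (U a))) has_vector_derivative icc_fun (state'' v)) (at a)"
  shows "(U has_vector_derivative v) (at a)"
proof -
  have "((\<lambda>b. norm (U b - U a - (b - a) *\<^sub>R v) / norm (b - a)) \<longlongrightarrow> 0 + 0 + 0) (at a)"
    unfolding norm_dirichlet_C2_def icc_fun_state_diff icc_fun_state_scaleR add_divide_distrib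
    using assms unfolding has_vector_derivative_def has_derivative_iff_norm
    by (intro tendsto_add) auto
  then show ?thesis
    unfolding has_vector_derivative_def has_derivative_iff_norm
    by (simp add: bounded_linear_scaleR_left)
qed

lemma bounded_linear_state_eval:
  assumes "x \<in> {-1..1}"
  shows "bounded_linear (\<lambda>u. state u x)"
proof (rule bounded_linear_intro[where K = 1])
  show "norm (state u x) \<le> norm u * 1" for u
    using norm_bounded[of "icc_fun (state u)" "Abs_icc x"] assms
      norm_ge_zero[of "icc_fun (state' u)"] norm_ge_zero[of "icc_fun (state'' u)"]
    unfolding norm_dirichlet_C2_def icc_fun_state
    by (simp add: Abs_icc_inverse del: norm_ge_zero)
qed simp_all

section \<open>The explicit branch\<close>

text \<open>Writing the quotient under the logarithm as a difference makes the dependence on the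
  parameter as easy to differentiate as the dependence on $x$.\<close>

lemma bratu_u_derivs:
  assumes "x \<in> {-1..1}"
  shows "state (bratu_u a) x = 2 * ln (cosh a) - 2 * ln (cosh (a * x))"
    and "state' (bratu_u a) x = - 2 * a * tanh (a * x)"
    and "state'' (bratu_u a) x = - 2 * a\<^sup>2 * (1 - (tanh (a * x))\<^sup>2)"
proof -
  have u: "state (bratu_u a) x = 2 * ln (cosh a) - 2 * ln (cosh (a * x))" if "x \<in> {-1..1}" for x
    using that by (simp add: state_bratu_u ln_div)
  then show "state (bratu_u a) x = 2 * ln (cosh a) - 2 * ln (cosh (a * x))" using assms .
  have 1: "(state (bratu_u a) has_vector_derivative - 2 * a * tanh (a * x)) (at x within {-1..1})"
    if "x \<in> {-1..1}" for x
  proof (rule has_vector_derivative_transform[OF that u])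
    show "((\<lambda>x. 2 * ln (cosh a) - 2 * ln (cosh (a * x))) has_vector_derivative
        - 2 * a * tanh (a * x)) (at x within {-1..1})"
      unfolding has_real_derivative_iff_has_vector_derivative[symmetric]
      by (auto intro!: derivative_eq_intros simp: tanh_def)
  qed
  have 2: "((\<lambda>x. - 2 * a * tanh (a * x)) has_vector_derivative - 2 * a\<^sup>2 * (1 - (tanh (a * x))\<^sup>2))
      (at x within {-1..1})" for x
    unfolding has_real_derivative_iff_has_vector_derivative[symmetric]
    by (auto intro!: derivative_eq_intros simp: power2_eq_square)
  have 3: "continuous_on {-1..1} (\<lambda>x. - 2 * a\<^sup>2 * (1 - (tanh (a * x))\<^sup>2))"
    by (auto intro!: continuous_intros)
  show "state' (bratu_u a) x = - 2 * a * tanh (a * x)"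
    and "state'' (bratu_u a) x = - 2 * a\<^sup>2 * (1 - (tanh (a * x))\<^sup>2)"
    using C2_iccI(2,3)[OF 1 2 3] assms by auto
qed

lemma state_bratu_u_0: "state (bratu_u a) 0 = 2 * ln (cosh a)"
  by (simp add: bratu_u_derivs)

lemma bratu_bratu_u: "bratu (bratu_u a, bratu_l a) = 0"
proof (rule bcontfun_eqI)
  fix x
  let ?x = "real_of_icc x"
  have "exp (2 * ln (cosh a) - 2 * ln (cosh (a * ?x))) = (cosh a)\<^sup>2 / (cosh (a * ?x))\<^sup>2"
    by (simp add: exp_diff exp_double)
  moreover have "1 - (tanh (a * ?x))\<^sup>2
      = ((cosh (a * ?x))\<^sup>2 - (sinh (a * ?x))\<^sup>2) / (cosh (a * ?x))\<^sup>2"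
    by (simp add: tanh_def power_divide diff_divide_distrib)
  moreover have "\<dots> = 1 / (cosh (a * ?x))\<^sup>2"
    by (simp add: cosh_square_eq)
  ultimately show "apply_bcontfun (bratu (bratu_u a, bratu_l a)) x = apply_bcontfun 0 x"
    by (simp add: apply_bratu bratu_u_derivs bratu_l_def power_divide)
qed

definition bratu_u_tangent :: "real \<Rightarrow> dirichlet_C2"
  where "bratu_u_tangent a = Abs_dirichlet_C2
    (\<lambda>x. if x \<in> {-1..1} then 2 * tanh a - 2 * x * tanh (a * x) else 0)"

definition bratu_l_tangent :: "real \<Rightarrow> real"
  where "bratu_l_tangent a = 4 * a * (cosh a - a * sinh a) / (cosh a) ^ 3"

lemma bratu_u_tangent_derivs:
  assumes "x \<in> {-1..1}"
  shows "state (bratu_u_tangent a) x = 2 * tanh a - 2 * x * tanh (a * x)"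
    and "state' (bratu_u_tangent a) x = - 2 * tanh (a * x) - 2 * a * x * (1 - (tanh (a * x))\<^sup>2)"
    and "state'' (bratu_u_tangent a) x =
      (1 - (tanh (a * x))\<^sup>2) * (4 * a\<^sup>2 * x * tanh (a * x) - 4 * a)"
proof -
  let ?v = "\<lambda>x. if x \<in> {-1..1} then 2 * tanh a - 2 * x * tanh (a * x) else 0"
  let ?v1 = "\<lambda>x. - 2 * tanh (a * x) - 2 * a * x * (1 - (tanh (a * x))\<^sup>2)"
  let ?v2 = "\<lambda>x. (1 - (tanh (a * x))\<^sup>2) * (4 * a\<^sup>2 * x * tanh (a * x) - 4 * a)"
  have 1: "(?v has_vector_derivative ?v1 x) (at x within {-1..1})" if "x \<in> {-1..1}" for x
  proof (rule has_vector_derivative_transform[OF that])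
    show "((\<lambda>x. 2 * tanh a - 2 * x * tanh (a * x)) has_vector_derivative ?v1 x) (at x within {-1..1})"
      unfolding has_real_derivative_iff_has_vector_derivative[symmetric]
      by (auto intro!: derivative_eq_intros simp: algebra_simps)
  qed simp
  have 2: "(?v1 has_vector_derivative ?v2 x) (at x within {-1..1})" for x
    unfolding has_real_derivative_iff_has_vector_derivative[symmetric]
    by (auto intro!: derivative_eq_intros simp: algebra_simps power2_eq_square)
  have 3: "continuous_on {-1..1} ?v2"
    by (auto intro!: continuous_intros)
  note C2 = C2_iccI[OF 1 2 3]
  have "state (bratu_u_tangent a) = ?v"
    unfolding bratu_u_tangent_def by (rule Abs_dirichlet_C2_inverse) (use C2(1) in auto)
  then show "state (bratu_u_tangent a) x = 2 * tanh a - 2 * x * tanh (a * x)"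
    "state' (bratu_u_tangent a) x = ?v1 x" "state'' (bratu_u_tangent a) x = ?v2 x"
    using C2(2,3) assms by simp_all
qed

lemma icc_fun_eqI:
  assumes "\<And>x. x \<in> {-1..1} \<Longrightarrow> f x = g x"
  shows "icc_fun f = icc_fun g"
  unfolding icc_fun_def using assms by simp

lemma icc_fun_bratu_u:
  "icc_fun (state (bratu_u a)) = icc_fun (\<lambda>x. 2 * ln (cosh a) - 2 * ln (cosh (a * x)))"
  "icc_fun (state' (bratu_u a)) = icc_fun (\<lambda>x. - 2 * a * tanh (a * x))"
  "icc_fun (state'' (bratu_u a)) = icc_fun (\<lambda>x. - 2 * a\<^sup>2 * (1 - (tanh (a * x))\<^sup>2))"
  by (rule icc_fun_eqI, erule bratu_u_derivs)+

lemma icc_fun_bratu_u_tangent: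
  "icc_fun (state (bratu_u_tangent a)) = icc_fun (\<lambda>x. 2 * tanh a - 2 * x * tanh (a * x))"
  "icc_fun (state' (bratu_u_tangent a)) =
    icc_fun (\<lambda>x. - 2 * tanh (a * x) - 2 * a * x * (1 - (tanh (a * x))\<^sup>2))"
  "icc_fun (state'' (bratu_u_tangent a)) =
    icc_fun (\<lambda>x. (1 - (tanh (a * x))\<^sup>2) * (4 * a\<^sup>2 * x * tanh (a * x) - 4 * a))"
  by (rule icc_fun_eqI, erule bratu_u_tangent_derivs)+

lemma bratu_u_has_vector_derivative:
  "(bratu_u has_vector_derivative bratu_u_tangent a) (at a)"
proof (rule has_vector_derivative_dirichlet_C2)
  show "((\<lambda>a. icc_fun (state (bratu_u a))) has_vector_derivative
      icc_fun (state (bratu_u_tangent a))) (at a)"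
    unfolding icc_fun_bratu_u icc_fun_bratu_u_tangent
    by (rule has_vector_derivative_icc_fun)
      (auto intro!: continuous_intros derivative_eq_intros simp: tanh_def ac_simps)
  show "((\<lambda>a. icc_fun (state' (bratu_u a))) has_vector_derivative
      icc_fun (state' (bratu_u_tangent a))) (at a)"
    unfolding icc_fun_bratu_u icc_fun_bratu_u_tangent
    by (rule has_vector_derivative_icc_fun)
      (auto intro!: continuous_intros derivative_eq_intros simp: algebra_simps)
  show "((\<lambda>a. icc_fun (state'' (bratu_u a))) has_vector_derivative
      icc_fun (state'' (bratu_u_tangent a))) (at a)"
    unfolding icc_fun_bratu_u icc_fun_bratu_u_tangent
    by (rule has_vector_derivative_icc_fun)
      (auto intro!: continuous_intros derivative_eq_intros simp: algebra_simps power2_eq_square)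
qed

lemma continuous_on_bratu_u_tangent: "continuous_on UNIV bratu_u_tangent"
  by (intro continuous_on_dirichlet_C2; unfold icc_fun_bratu_u_tangent;
      rule continuous_on_icc_fun_parameter) (auto intro!: continuous_intros)

lemma bratu_l_has_real_derivative:
  "(bratu_l has_real_derivative bratu_l_tangent a) (at a)"
  unfolding bratu_l_def[abs_def] bratu_l_tangent_def
  by (auto intro!: derivative_eq_intros simp: field_simps power2_eq_square power3_eq_cube)

lemma continuous_on_bratu_l_tangent: "continuous_on UNIV bratu_l_tangent"
  unfolding bratu_l_tangent_def[abs_def] by (auto intro!: continuous_intros)

text \<open>The branch is shifted so that the parameter value $0$ hits the prescribed point.\<close>

lemma bratu_branch_has_vector_derivative:
  "((\<lambda>s. (bratu_u (a + s), bratu_l (a + s))) has_vector_derivative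
     (bratu_u_tangent (a + s), bratu_l_tangent (a + s))) (at s)"
proof -
  have "((\<lambda>a. (bratu_u a, bratu_l a)) has_vector_derivative
     (bratu_u_tangent (a + s), bratu_l_tangent (a + s))) (at (a + s))"
    using bratu_l_has_real_derivative
    by (intro has_vector_derivative_Pair bratu_u_has_vector_derivative)
      (simp add: has_real_derivative_iff_has_vector_derivative)
  moreover have "((\<lambda>s. a + s) has_vector_derivative 1) (at s)"
    by (auto intro!: derivative_eq_intros)
  ultimately show ?thesis
    using vector_diff_chain_at[of "\<lambda>s. a + s" 1 s "\<lambda>a. (bratu_u a, bratu_l a)"]
    by (simp add: o_def)
qed

section \<open>All solutions with a positive parameter\<close>

lemma icc_constant_if_deriv_zero:
  fixes f :: "real \<Rightarrow> real"
  assumes "\<And>x. x \<in> {-1..1} \<Longrightarrow> (f has_real_derivative 0) (at x within {-1..1})"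
    and "x \<in> {-1..1}" "y \<in> {-1..1}"
  shows "f x = f y"
  using has_field_derivative_zero_constant[of "{-1..1}" f] assms by (auto 4 3)

text \<open>The substitution $v = e^{-u/2}$ linearises the equation: $v'' = (u'^2/4 - u''/2) v$, and
  inserting $u'' = -\lambda e^u$ turns the bracket into half of the conserved energy. The linear
  equation $v'' = \theta^2 v$ is then solved through its two first integrals
  $(v' \pm \theta v) e^{\mp\theta x}$. Positivity of $\lambda$ makes the energy positive, so that
  $\theta$ is real and nonzero.\<close>

lemma bratu_solution_explicit:
  assumes F: "bratu (u, l) = 0" and l: "l > 0"
  shows "\<exists>\<theta>>0. u = bratu_u \<theta> \<and> l = bratu_l \<theta>"
proof -
  have ode: "state'' u x = - l * exp (state u x)" if "x \<in> {-1..1}" for x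
    using apply_bratu[of u l "Abs_icc x"] that F by (simp add: Abs_icc_inverse)
  note D = state_deriv(1,2)[of _ u, folded has_real_derivative_iff_has_vector_derivative]
  define E where "E x = (state' u x)\<^sup>2 / 2 + l * exp (state u x)" for x
  have E: "E x = E 0" if x: "x \<in> {-1..1}" for x
  proof (rule icc_constant_if_deriv_zero[OF _ x])
    fix x :: real assume x: "x \<in> {-1..1}"
    show "(E has_real_derivative 0) (at x within {-1..1})"
      unfolding E_def[abs_def]
      by (rule derivative_eq_intros D[OF x] refl | simp add: ode[OF x])+
  qed simp
  define \<theta> where "\<theta> = sqrt (E 0 / 2)"
  have "E 0 > 0" using l by (auto simp: E_def intro!: add_nonneg_pos)
  then have \<theta>: "\<theta> > 0" and \<theta>2: "2 * \<theta>\<^sup>2 = E 0" by (auto simp: \<theta>_def)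
  define v where "v x = exp (- state u x / 2)" for x
  define v1 where "v1 x = - state' u x / 2 * v x" for x
  have dv: "(v has_real_derivative v1 x) (at x within {-1..1})" if x: "x \<in> {-1..1}" for x
    unfolding v_def[abs_def] v1_def
    by (rule derivative_eq_intros D[OF x] refl | simp)+
  have dv1: "(v1 has_real_derivative \<theta>\<^sup>2 * v x) (at x within {-1..1})" if x: "x \<in> {-1..1}" for x
  proof -
    have "(v1 has_real_derivative (- state'' u x / 2 + (state' u x)\<^sup>2 / 4) * v x) (at x within {-1..1})"
      unfolding v1_def[abs_def]
      by (rule derivative_eq_intros D[OF x] dv[OF x] refl |
          simp add: v1_def power2_eq_square algebra_simps)+
    moreover have "- state'' u x / 2 + (state' u x)\<^sup>2 / 4 = \<theta>\<^sup>2"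
      using \<theta>2 E[OF x] ode[OF x] by (simp add: E_def)
    ultimately show ?thesis by simp
  qed
  have p: "(v1 x + \<theta> * v x) * exp (- \<theta> * x) = v1 0 + \<theta> * v 0" if x: "x \<in> {-1..1}" for x
  proof -
    have "((\<lambda>x. (v1 x + \<theta> * v x) * exp (- \<theta> * x)) has_real_derivative 0) (at x within {-1..1})"
      if x: "x \<in> {-1..1}" for x
      by (rule derivative_eq_intros dv[OF x] dv1[OF x] refl |
          simp add: power2_eq_square algebra_simps)+
    from icc_constant_if_deriv_zero[OF this x, of 0] show ?thesis by simp
  qed
  have q: "(v1 x - \<theta> * v x) * exp (\<theta> * x) = v1 0 - \<theta> * v 0" if x: "x \<in> {-1..1}" for x
  proof -
    have "((\<lambda>x. (v1 x - \<theta> * v x) * exp (\<theta> * x)) has_real_derivative 0) (at x within {-1..1})"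
      if x: "x \<in> {-1..1}" for x
      by (rule derivative_eq_intros dv[OF x] dv1[OF x] refl |
          simp add: power2_eq_square algebra_simps)+
    from icc_constant_if_deriv_zero[OF this x, of 0] show ?thesis by simp
  qed
  have v: "\<theta> * v x = \<theta> * v 0 * cosh (\<theta> * x) + v1 0 * sinh (\<theta> * x)" if x: "x \<in> {-1..1}" for x
  proof -
    have "v1 x + \<theta> * v x = (v1 0 + \<theta> * v 0) * exp (\<theta> * x)"
      using p[OF x] by (simp add: exp_minus field_simps)
    moreover have "v1 x - \<theta> * v x = (v1 0 - \<theta> * v 0) * exp (- (\<theta> * x))"
      using q[OF x] by (simp add: exp_minus field_simps)
    ultimately have "2 * (\<theta> * v x) =
        (v1 0 + \<theta> * v 0) * exp (\<theta> * x) - (v1 0 - \<theta> * v 0) * exp (- (\<theta> * x))"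
      by linarith
    then show ?thesis by (simp add: cosh_field_def sinh_field_def field_simps)
  qed
  have "v 1 = 1" "v (-1) = 1" by (simp_all add: v_def)
  with v[of 1] v[of "-1"] have "\<theta> = \<theta> * v 0 * cosh \<theta> + v1 0 * sinh \<theta>"
    and "\<theta> = \<theta> * v 0 * cosh \<theta> - v1 0 * sinh \<theta>" by simp_all
  then have "v1 0 * sinh \<theta> = 0" and "\<theta> * v 0 * cosh \<theta> = \<theta>" by linarith+
  then have "v1 0 = 0" "v 0 = 1 / cosh \<theta>" using \<theta> by (auto simp: field_simps)
  then have vx: "v x = cosh (\<theta> * x) / cosh \<theta>" if "x \<in> {-1..1}" for x
    using v[OF that] \<theta> by (simp add: field_simps)
  have "state u x = state (bratu_u \<theta>) x" for x
  proof (cases "x \<in> {-1..1}")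
    case True
    have "state u x = - 2 * ln (v x)" by (simp add: v_def)
    with vx[OF True] True show ?thesis by (simp add: state_bratu_u)
  qed (simp_all add: state_outside)
  then have u: "u = bratu_u \<theta>" by (simp add: state_inject[symmetric] fun_eq_iff)
  \<comment> \<open>The function determines the parameter: both values solve the equation for the same $u$, so
    comparing the equations at the midpoint suffices.\<close>
  have "state'' u 0 + l * exp (state u 0) = 0"
    using F apply_bratu[of u l "Abs_icc 0"] by (simp add: Abs_icc_inverse)
  moreover have "state'' u 0 + bratu_l \<theta> * exp (state u 0) = 0"
    using bratu_bratu_u[of \<theta>] apply_bratu[of u "bratu_l \<theta>" "Abs_icc 0"] u
    by (simp add: Abs_icc_inverse)
  ultimately have "l * exp (state u 0) = bratu_l \<theta> * exp (state u 0)" by linarith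
  then have "l = bratu_l \<theta>" by simp
  with u \<theta> show ?thesis by blast
qed

lemma arcosh_exp_state_bratu_u:
  assumes "a > 0"
  shows "arcosh (exp (state (bratu_u a) 0 / 2)) = a"
  using assms by (simp add: state_bratu_u_0 arcosh_cosh_real)

text \<open>The parameter of a solution is thus a function of its midpoint value, given by a formula
  that makes sense on the whole space and is differentiable where that value is positive.\<close>

lemma branch_point_of_solution:
  fixes p :: "dirichlet_C2 \<times> real"
  assumes "bratu p = 0" "snd p > 0"
  defines "\<theta> \<equiv> arcosh (exp (state (fst p) 0 / 2))"
  shows "\<theta> > 0" "p = (bratu_u \<theta>, bratu_l \<theta>)" "state (fst p) 0 = 2 * ln (cosh \<theta>)"
proof -
  obtain a where "a > 0" "fst p = bratu_u a" "snd p = bratu_l a"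
    using bratu_solution_explicit[of "fst p" "snd p"] assms by auto
  moreover from this have "\<theta> = a" by (simp add: \<theta>_def arcosh_exp_state_bratu_u)
  ultimately show "\<theta> > 0" "p = (bratu_u \<theta>, bratu_l \<theta>)" "state (fst p) 0 = 2 * ln (cosh \<theta>)"
    by (auto simp: prod_eq_iff state_bratu_u_0)
qed

section \<open>The branch through the turning point\<close>

theorem theorem3p1:
  fixes \<alpha> :: real
  assumes "\<alpha> > 0" and "\<alpha> * tanh \<alpha> = 1"
    and F_C1: "\<exists>F' :: dirichlet_C2 \<times> real \<Rightarrow> (dirichlet_C2 \<times> real) \<Rightarrow>\<^sub>L (icc \<Rightarrow>\<^sub>C real).
      (\<forall>p. (bratu has_derivative blinfun_apply (F' p)) (at p)) \<and> continuous_on UNIV F'"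
    and zero: "bratu (bratu_u \<alpha>, bratu_l \<alpha>) = 0"
    and kernel: "dim {w. bratu_deriv_u (bratu_u \<alpha>) (bratu_l \<alpha>) w = 0} = 1"
    and range: "bratu_deriv_l (bratu_u \<alpha>) (bratu_l \<alpha>)
      \<notin> range (bratu_deriv_u (bratu_u \<alpha>) (bratu_l \<alpha>))"
  shows "\<exists>\<delta>>0. \<exists>(u0 :: real \<Rightarrow> dirichlet_C2) (l0 :: real \<Rightarrow> real).
    (u0 0, l0 0) = (bratu_u \<alpha>, bratu_l \<alpha>) \<and>
    bratu_curve \<delta> (\<lambda>s. (u0 s, l0 s)) \<and>
    unique_bratu_curve \<delta> (\<lambda>s. (u0 s, l0 s))"
proof -
  let ?c = "\<lambda>s. (bratu_u (\<alpha> + s), bratu_l (\<alpha> + s))"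
  let ?t = "\<lambda>s. (bratu_u_tangent (\<alpha> + s), bratu_l_tangent (\<alpha> + s))"
  let ?\<theta> = "\<lambda>p :: dirichlet_C2 \<times> real. arcosh (exp (state (fst p) 0 / 2))"
  \<comment> \<open>The first condition puts a solution on the explicit branch, the second one says
    $\theta < 2\alpha$, which is the upper end of the curve when the radius is $\alpha$.\<close>
  define U :: "(dirichlet_C2 \<times> real) set"
    where "U = {p. 0 < snd p \<and> state (fst p) 0 < 2 * ln (cosh (2 * \<alpha>))}"
  have curve: "bratu_curve \<alpha> ?c"
    unfolding bratu_curve_def C1_differentiable_on_def
  proof (intro conjI ballI exI[of _ ?t])
    show "continuous_on {-\<alpha><..<\<alpha>} ?t"
      by (intro continuous_intros continuous_on_compose2[OF continuous_on_bratu_u_tangent]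
          continuous_on_compose2[OF continuous_on_bratu_l_tangent]) auto
  qed (rule bratu_branch_has_vector_derivative bratu_bratu_u)+
  have immersion: "vector_derivative ?c (at s) \<noteq> 0" if "s \<in> {-\<alpha><..<\<alpha>}" for s
  proof -
    \<comment> \<open>The fold makes the $\lambda$ component of the tangent vanish at $s = 0$, so the nonzero
      component has to come from the function.\<close>
    have "state (bratu_u_tangent (\<alpha> + s)) 0 > 0"
      using that by (simp add: bratu_u_tangent_derivs)
    then have "bratu_u_tangent (\<alpha> + s) \<noteq> 0" by auto
    then show ?thesis
      unfolding vector_derivative_at[OF bratu_branch_has_vector_derivative] by (simp add: zero_prod_def)
  qed
  have eval: "bounded_linear (\<lambda>p :: dirichlet_C2 \<times> real. state (fst p) 0)"
    using bounded_linear_compose[OF bounded_linear_state_eval[of 0] bounded_linear_fst] by simp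
  have U_open: "open U"
    unfolding U_def
    by (intro open_Collect_conj open_Collect_less continuous_intros bounded_linear.continuous_on[OF eval])
  have c0: "?c 0 \<in> U"
    using \<open>\<alpha> > 0\<close> by (simp add: U_def bratu_l_def state_bratu_u_0 cosh_real_nonneg_less_iff)
  have on_branch: "?\<theta> p - \<alpha> \<in> {-\<alpha><..<\<alpha>} \<and> p = ?c (?\<theta> p - \<alpha>)" if "p \<in> U" "bratu p = 0" for p
  proof -
    note b = branch_point_of_solution[OF \<open>bratu p = 0\<close>]
    have "0 < snd p" using that by (simp add: U_def)
    note b = b[OF this]
    have "2 * ln (cosh (?\<theta> p)) < 2 * ln (cosh (2 * \<alpha>))"
      using b(3) that(1) unfolding U_def by simp
    then have "cosh (?\<theta> p) < cosh (2 * \<alpha>)"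
      unfolding mult_less_cancel_left_pos[OF zero_less_numeral]
        ln_less_cancel_iff[OF cosh_real_pos cosh_real_pos] .
    then have "?\<theta> p < 2 * \<alpha>"
      using b(1) \<open>\<alpha> > 0\<close> by (subst (asm) cosh_real_nonneg_less_iff) auto
    then show ?thesis using b(1,2) by simp
  qed
  have repar: "\<exists>r\<in>{0<..e}. \<exists>\<phi> :: real \<Rightarrow> real. \<phi> C1_differentiable_on {-r<..<r} \<and> \<phi> 0 = 0 \<and>
        (\<forall>t\<in>{-r<..<r}. \<phi> t \<in> {-\<alpha><..<\<alpha>} \<and> c' t = ?c (\<phi> t))"
    if "e > 0" and c': "bratu_curve e c'" "c' 0 = ?c 0" for e c'
  proof -
    obtain D where D: "\<And>t. t \<in> {-e<..<e} \<Longrightarrow> (c' has_vector_derivative D t) (at t)"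
      and contD: "continuous_on {-e<..<e} D" and sol: "\<And>t. t \<in> {-e<..<e} \<Longrightarrow> bratu (c' t) = 0"
      using c'(1) unfolding bratu_curve_def C1_differentiable_on_def by blast
    have contc: "continuous_on {-e<..<e} c'"
      using D by (meson continuous_at_imp_continuous_on has_vector_derivative_continuous)
    have "open ({-e<..<e} \<inter> c' -` U)"
      by (rule continuous_open_preimage[OF contc open_greaterThanLessThan U_open])
    moreover have "0 \<in> {-e<..<e} \<inter> c' -` U" using c0 c'(2) \<open>e > 0\<close> by simp
    ultimately obtain r where r: "r > 0" and ball: "ball 0 r \<subseteq> {-e<..<e} \<inter> c' -` U"
      by (meson open_contains_ball)
    define \<rho> where "\<rho> = min r e"
    have \<rho>: "\<rho> \<in> {0<..e}" using r \<open>e > 0\<close> by (simp add: \<rho>_def)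
    have in_U: "t \<in> {-e<..<e}" "c' t \<in> U" if "t \<in> {-\<rho><..<\<rho>}" for t
      using ball that by (auto simp: \<rho>_def subset_eq dist_real_def)
    define h where "h t = state (fst (c' t)) 0" for t
    define h1 where "h1 t = state (fst (D t)) 0" for t
    have h: "(h has_real_derivative h1 t) (at t)" if "t \<in> {-\<rho><..<\<rho>}" for t
      using bounded_linear.has_vector_derivative[OF eval D[OF in_U(1)[OF that]]]
      by (simp add: has_real_derivative_iff_has_vector_derivative h_def[abs_def] h1_def)
    have h_pos: "h t > 0" if "t \<in> {-\<rho><..<\<rho>}" for t
    proof -
      have "bratu (c' t) = 0" "0 < snd (c' t)"
        using sol in_U[OF that] by (auto simp: U_def)
      from branch_point_of_solution[OF this] have "h t = 2 * ln (cosh (?\<theta> (c' t)))"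
        and "?\<theta> (c' t) > 0" by (simp_all add: h_def)
      then show ?thesis using cosh_real_nonneg_less_iff[of 0 "?\<theta> (c' t)"] by simp
    qed
    \<comment> \<open>arcosh has infinite slope at 1, so the reparametrisation is smooth only because
      $h$ stays positive.\<close>
    have sq_neq_1: "(exp (h t / 2))\<^sup>2 \<noteq> 1" if "t \<in> {-\<rho><..<\<rho>}" for t
      using h_pos[OF that] by (simp flip: exp_double)
    define \<phi> where "\<phi> t = arcosh (exp (h t / 2)) - \<alpha>" for t
    have "continuous_on {-\<rho><..<\<rho>} h1"
      unfolding h1_def
      by (rule bounded_linear.continuous_on[OF eval continuous_on_subset[OF contD]])
        (use in_U in blast)
    moreover have "continuous_on {-\<rho><..<\<rho>} h"
      using h by (meson DERIV_isCont continuous_at_imp_continuous_on)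
    ultimately have cont_\<phi>: "continuous_on {-\<rho><..<\<rho>}
        (\<lambda>t. 1 / sqrt ((exp (h t / 2))\<^sup>2 - 1) * (exp (h t / 2) * (h1 t / 2)))"
      using sq_neq_1 by (auto intro!: continuous_intros)
    have deriv_\<phi>: "(\<phi> has_vector_derivative
        1 / sqrt ((exp (h t / 2))\<^sup>2 - 1) * (exp (h t / 2) * (h1 t / 2))) (at t)"
      if t: "t \<in> {-\<rho><..<\<rho>}" for t
    proof -
      have exp_h: "((\<lambda>t. exp (h t / 2)) has_real_derivative exp (h t / 2) * (h1 t / 2)) (at t)"
        by (intro DERIV_chain2[OF DERIV_exp] DERIV_cdivide h[OF t])
      have "(arcosh has_real_derivative 1 / sqrt ((exp (h t / 2))\<^sup>2 - 1)) (at (exp (h t / 2)))"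
        using h_pos[OF t] by (intro arcosh_real_has_field_derivative) simp
      from DERIV_chain2[OF this exp_h]
      have "((\<lambda>t. arcosh (exp (h t / 2)) - \<alpha>) has_real_derivative
          1 / sqrt ((exp (h t / 2))\<^sup>2 - 1) * (exp (h t / 2) * (h1 t / 2)) - 0) (at t)"
        by (rule DERIV_diff[OF _ DERIV_const])
      then show ?thesis
        unfolding has_real_derivative_iff_has_vector_derivative \<phi>_def[abs_def] diff_0_right .
    qed
    have "\<phi> C1_differentiable_on {-\<rho><..<\<rho>}"
      unfolding C1_differentiable_on_def by (rule exI, rule conjI[OF ballI[OF deriv_\<phi>] cont_\<phi>])
    moreover have "\<phi> 0 = 0"
      using \<open>\<alpha> > 0\<close> c'(2) by (simp add: \<phi>_def h_def arcosh_exp_state_bratu_u)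
    moreover have "\<phi> t \<in> {-\<alpha><..<\<alpha>} \<and> c' t = ?c (\<phi> t)" if "t \<in> {-\<rho><..<\<rho>}" for t
      using on_branch[OF in_U(2)[OF that] sol[OF in_U(1)[OF that]]] by (simp add: \<phi>_def h_def)
    ultimately show ?thesis using \<rho> by blast
  qed
  have "unique_bratu_curve \<alpha> ?c"
    unfolding unique_bratu_curve_def
  proof (intro conjI ballI allI impI)
    show "\<exists>U. open U \<and> ?c 0 \<in> U \<and> (\<forall>p\<in>U. bratu p = 0 \<longrightarrow> p \<in> ?c ` {-\<alpha><..<\<alpha>})"
    proof (intro exI conjI ballI impI)
      show "p \<in> ?c ` {-\<alpha><..<\<alpha>}" if "p \<in> U" "bratu p = 0" for p
        using on_branch[OF that] by (intro image_eqI[of p _ "?\<theta> p - \<alpha>"]) blast+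
    qed (rule U_open c0)+
  qed (rule immersion repar; (elim conjE)?; assumption)+
  with curve \<open>\<alpha> > 0\<close> show ?thesis
    by (intro exI[of _ \<alpha>] conjI exI[of _ "\<lambda>s. bratu_u (\<alpha> + s)"] exI[of _ "\<lambda>s. bratu_l (\<alpha> + s)"]) simp_all
qed

end
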